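(* For every quasi-copula $Q\colon [0,1]^2\to[0,1]$ there exist copulas $\{C_j\}_{j=1}^\infty$ (functions $[0,1]^2\to[0,1]$) and real numbers $\{\gamma_j\}_{j=1}^\infty$ with $\sum_{j=1}^\infty \gamma_j=1$ such that $$Q(x,y)=\sum_{j=1}^\infty \gamma_j C_j(x,y)\qquad\text{for all } x,y\in[0,1],$$ the series converges uniformly on $[0,1]^2$, and all of its partial sums are positive multiples of quasi-copulas (i.e. for every $N\ge 1$ there are a real number $c>0$ and a quasi-copula $Q'$ with $\sum_{j=1}^N\gamma_jC_j=c\,Q'$).
   Context: A quasi-copula is a function $Q\colon[0,1]^2\to[0,1]$ such that: (i) $Q(x,0)=Q(0,y)=0$ for all $x,y\in[0,1]$ (grounded); (ii) $Q(x,1)=x$ and $Q(1,y)=y$ for all $x,y\in[0,1]$ (uniform marginals); (iii) $Q$ is increasing (i.e. nondecreasing) in each of its arguments; (iv) $|Q(x_2,y_2)-Q(x_1,y_1)|\le|x_2-x_1|+|y_2-y_1|$ for all $(x_1,y_1),(x_2,y_2)\in[0,1]^2$. A copula is a function $C\colon[0,1]^2\to[0,1]$ satisfying (i), (ii) and (v) $C(x_2,y_2)+C(x_1,y_1)-C(x_2,y_1)-C(x_1,y_2)\ge0$ whenever $0\le x_1\le x_2\le1$ and $0\le y_1\le y_2\le1$ (2-increasing). *)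

theory Defs
  imports "HOL-Analysis.Analysis"
begin

(* A function on the unit square is represented by a total curried function on the reals.
   Every condition below concerns only its values on the square; values elsewhere are arbitrary. *)

definition maps_unit_square :: "(real \<Rightarrow> real \<Rightarrow> real) \<Rightarrow> bool" where
  "maps_unit_square F \<longleftrightarrow> (\<forall>x\<in>{0..1}. \<forall>y\<in>{0..1}. F x y \<in> {0..1})"

definition grounded :: "(real \<Rightarrow> real \<Rightarrow> real) \<Rightarrow> bool" where
  "grounded F \<longleftrightarrow> (\<forall>x\<in>{0..1}. F x 0 = 0) \<and> (\<forall>y\<in>{0..1}. F 0 y = 0)"

definition uniform_marginals :: "(real \<Rightarrow> real \<Rightarrow> real) \<Rightarrow> bool" where
  "uniform_marginals F \<longleftrightarrow> (\<forall>x\<in>{0..1}. F x 1 = x) \<and> (\<forall>y\<in>{0..1}. F 1 y = y)"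

definition increasing_in_each :: "(real \<Rightarrow> real \<Rightarrow> real) \<Rightarrow> bool" where
  "increasing_in_each F \<longleftrightarrow>
     (\<forall>y\<in>{0..1}. mono_on {0..1} (\<lambda>x. F x y)) \<and> (\<forall>x\<in>{0..1}. mono_on {0..1} (F x))"

definition one_lipschitz :: "(real \<Rightarrow> real \<Rightarrow> real) \<Rightarrow> bool" where
  "one_lipschitz F \<longleftrightarrow>
     (\<forall>x1\<in>{0..1}. \<forall>y1\<in>{0..1}. \<forall>x2\<in>{0..1}. \<forall>y2\<in>{0..1}.
        \<bar>F x2 y2 - F x1 y1\<bar> \<le> \<bar>x2 - x1\<bar> + \<bar>y2 - y1\<bar>)"

definition two_increasing :: "(real \<Rightarrow> real \<Rightarrow> real) \<Rightarrow> bool" where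
  "two_increasing F \<longleftrightarrow>
     (\<forall>x1 x2 y1 y2. 0 \<le> x1 \<and> x1 \<le> x2 \<and> x2 \<le> 1 \<and> 0 \<le> y1 \<and> y1 \<le> y2 \<and> y2 \<le> 1 \<longrightarrow>
        F x2 y2 + F x1 y1 - F x2 y1 - F x1 y2 \<ge> 0)"

definition quasi_copula :: "(real \<Rightarrow> real \<Rightarrow> real) \<Rightarrow> bool" where
  "quasi_copula Q \<longleftrightarrow>
     maps_unit_square Q \<and> grounded Q \<and> uniform_marginals Q \<and> increasing_in_each Q \<and>
     one_lipschitz Q"

definition copula :: "(real \<Rightarrow> real \<Rightarrow> real) \<Rightarrow> bool" where
  "copula C \<longleftrightarrow>
     maps_unit_square C \<and> grounded C \<and> uniform_marginals C \<and> two_increasing C"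

end

theory Submission
  imports Defs "HOL-Real_Asymp.Real_Asymp"
begin

text \<open>
A quasi-copula \<open>F\<close> whose mass density is bounded below by \<open>-M\<close> is a combination of two copulas:
adding \<open>M\<close> times the product copula \<open>xy\<close> makes it 2-increasing, so
\<open>F = (1 + M) A - M xy\<close> with the copula \<open>A = (F + M xy) / (1 + M)\<close>. An arbitrary \<open>Q\<close> need not be of
this kind, but its piecewise bilinear interpolant on the grid of \<open>n\<^sup>2\<close> cells is, with \<open>M = n\<close>,
and it is a quasi-copula within \<open>4/n\<close> of \<open>Q\<close> (\<open>quasi_copula_bilinear_interpolant\<close>,
\<open>two_increasing_interpolant_plus_product\<close>, \<open>bilinear_interpolant_error\<close>).

Telescoping along the interpolants themselves would give a series whose terms have size about \<open>n\<close>,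
so that it could not converge. The path from one approximant to the next therefore has to be
travelled in small steps. Running averages \<open>T\<^sub>j\<close> of interpolants \<open>R\<^sub>0, \<dots>, R\<^sub>j\<close> do this:
\<open>T\<^sub>j\<^sub>+\<^sub>1 - T\<^sub>j = (R\<^sub>j\<^sub>+\<^sub>1 - T\<^sub>j) / (j + 2)\<close>. If \<open>R\<^sub>0, \<dots>, R\<^sub>j\<^sub>+\<^sub>1\<close> live on grids with at most
\<open>m\<close> subdivisions, this difference is \<open>\<epsilon> (P - N)\<close> with the copulas
\<open>P = (R\<^sub>j\<^sub>+\<^sub>1 + m xy) / (1 + m)\<close>, \<open>N = (T\<^sub>j + m xy) / (1 + m)\<close> and \<open>\<epsilon> = (1 + m) / (j + 2)\<close>.
With \<open>m\<close> of order \<open>\<surd>j\<close> the step sizes \<open>\<epsilon>\<close> tend to \<open>0\<close> while \<open>T\<^sub>j\<close> still tends to \<open>Q\<close>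
(\<open>slow_average_error\<close>).

The series starts with \<open>T\<^sub>0 = xy\<close> and then alternately adds \<open>\<epsilon> P\<close> and subtracts \<open>\<epsilon> N\<close>
(\<open>series_from_small_copula_steps\<close>). Its partial sums are \<open>T\<^sub>j\<close>, a quasi-copula, and
\<open>T\<^sub>j + \<epsilon> P\<close>, which is \<open>1 + \<epsilon>\<close> times a convex combination of quasi-copulas. Adding before
subtracting matters, since \<open>T\<^sub>j - \<epsilon> N\<close> may fail to be increasing. That the coefficients sum to
\<open>1\<close> is the convergence statement at the corner \<open>(1, 1)\<close>, where every copula and \<open>Q\<close> equal \<open>1\<close>.
\<close>

section \<open>Quasi-copulas and copulas\<close>

text \<open>
Monotonicity and the Lipschitz condition together say that each one-variable increment lies between
\<open>0\<close> and the increment of the argument. This form is preserved by sums and averages directly, and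
with the boundary values it also confines \<open>F\<close> to \<open>[0, 1]\<close>.
\<close>

lemma quasi_copulaI:
  assumes "\<And>x. x \<in> {0..1} \<Longrightarrow> F x 0 = 0" "\<And>y. y \<in> {0..1} \<Longrightarrow> F 0 y = 0"
    and "\<And>x. x \<in> {0..1} \<Longrightarrow> F x 1 = x" and mY: "\<And>y. y \<in> {0..1} \<Longrightarrow> F 1 y = y"
    and X: "\<And>x1 x2 y. 0 \<le> x1 \<Longrightarrow> x1 \<le> x2 \<Longrightarrow> x2 \<le> 1 \<Longrightarrow> y \<in> {0..1} \<Longrightarrow>
      F x2 y - F x1 y \<in> {0..x2 - x1}"
    and Y: "\<And>x y1 y2. 0 \<le> y1 \<Longrightarrow> y1 \<le> y2 \<Longrightarrow> y2 \<le> 1 \<Longrightarrow> x \<in> {0..1} \<Longrightarrow>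
      F x y2 - F x y1 \<in> {0..y2 - y1}"
  shows "quasi_copula F"
  unfolding quasi_copula_def
proof (intro conjI)
  show "grounded F" "uniform_marginals F"
    using assms(1-4) by (auto simp: grounded_def uniform_marginals_def)
  show "maps_unit_square F"
    unfolding maps_unit_square_def
  proof (intro ballI)
    fix x y :: real assume "x \<in> {0..1}" "y \<in> {0..1}"
    then show "F x y \<in> {0..1}"
      using X[of 0 x y] X[of x 1 y] assms(2)[of y] mY[of y] by auto
  qed
  show "increasing_in_each F"
    unfolding increasing_in_each_def
  proof (intro conjI ballI mono_onI)
    fix x y z :: real
    assume "y \<in> {0..1}" "x \<in> {0..1}" "z \<in> {0..1}" "x \<le> z"
    then show "F x y \<le> F z y" using X[of x z y] by auto
  next
    fix x y z :: real
    assume "x \<in> {0..1}" "y \<in> {0..1}" "z \<in> {0..1}" "y \<le> z"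
    then show "F x y \<le> F x z" using Y[of y z x] by auto
  qed
  have lipX: "\<bar>F x2 y - F x1 y\<bar> \<le> \<bar>x2 - x1\<bar>"
    if "x1 \<in> {0..1}" "x2 \<in> {0..1}" "y \<in> {0..1}" for x1 x2 y
    using X[of x1 x2 y] X[of x2 x1 y] that by (cases "x1 \<le> x2") auto
  have lipY: "\<bar>F x y2 - F x y1\<bar> \<le> \<bar>y2 - y1\<bar>"
    if "y1 \<in> {0..1}" "y2 \<in> {0..1}" "x \<in> {0..1}" for x y1 y2
    using Y[of y1 y2 x] Y[of y2 y1 x] that by (cases "y1 \<le> y2") auto
  show "one_lipschitz F"
    unfolding one_lipschitz_def
  proof (intro ballI)
    fix x1 y1 x2 y2 :: real
    assume *: "x1 \<in> {0..1}" "y1 \<in> {0..1}" "x2 \<in> {0..1}" "y2 \<in> {0..1}"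
    show "\<bar>F x2 y2 - F x1 y1\<bar> \<le> \<bar>x2 - x1\<bar> + \<bar>y2 - y1\<bar>"
      using lipX[of x1 x2 y2] lipY[of y1 y2 x1] * by linarith
  qed
qed

lemma quasi_copulaD:
  assumes "quasi_copula F"
  shows "\<And>x. x \<in> {0..1} \<Longrightarrow> F x 0 = 0" "\<And>y. y \<in> {0..1} \<Longrightarrow> F 0 y = 0"
    "\<And>x. x \<in> {0..1} \<Longrightarrow> F x 1 = x" "\<And>y. y \<in> {0..1} \<Longrightarrow> F 1 y = y"
    "\<And>x1 x2 y. 0 \<le> x1 \<Longrightarrow> x1 \<le> x2 \<Longrightarrow> x2 \<le> 1 \<Longrightarrow> y \<in> {0..1} \<Longrightarrow>
      F x2 y - F x1 y \<in> {0..x2 - x1}"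
    "\<And>x y1 y2. 0 \<le> y1 \<Longrightarrow> y1 \<le> y2 \<Longrightarrow> y2 \<le> 1 \<Longrightarrow> x \<in> {0..1} \<Longrightarrow>
      F x y2 - F x y1 \<in> {0..y2 - y1}"
proof -
  have G: "grounded F" and U: "uniform_marginals F" and I: "increasing_in_each F"
    and L: "one_lipschitz F"
    using assms by (auto simp: quasi_copula_def)
  show "\<And>x. x \<in> {0..1} \<Longrightarrow> F x 0 = 0" "\<And>y. y \<in> {0..1} \<Longrightarrow> F 0 y = 0"
    "\<And>x. x \<in> {0..1} \<Longrightarrow> F x 1 = x" "\<And>y. y \<in> {0..1} \<Longrightarrow> F 1 y = y"
    using G U by (auto simp: grounded_def uniform_marginals_def)
  show "F x2 y - F x1 y \<in> {0..x2 - x1}"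
    if "0 \<le> x1" "x1 \<le> x2" "x2 \<le> 1" "y \<in> {0..1}" for x1 x2 y
  proof -
    have "F x1 y \<le> F x2 y"
      using I that unfolding increasing_in_each_def mono_on_def by auto
    moreover have "\<bar>F x2 y - F x1 y\<bar> \<le> \<bar>x2 - x1\<bar> + \<bar>y - y\<bar>"
      by (rule L[unfolded one_lipschitz_def, rule_format]) (use that in auto)
    ultimately show ?thesis using that by auto
  qed
  show "F x y2 - F x y1 \<in> {0..y2 - y1}"
    if "0 \<le> y1" "y1 \<le> y2" "y2 \<le> 1" "x \<in> {0..1}" for x y1 y2
  proof -
    have "F x y1 \<le> F x y2"
      using I that unfolding increasing_in_each_def mono_on_def by auto
    moreover have "\<bar>F x y2 - F x y1\<bar> \<le> \<bar>x - x\<bar> + \<bar>y2 - y1\<bar>"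
      by (rule L[unfolded one_lipschitz_def, rule_format]) (use that in auto)
    ultimately show ?thesis using that by auto
  qed
qed

lemma quasi_copula_transpose:
  assumes "quasi_copula F"
  shows "quasi_copula (\<lambda>x y. F y x)"
  using quasi_copulaD[OF assms] by (intro quasi_copulaI) auto

text \<open>
An increment \<open>F x2 y - F x1 y\<close> is the mass of the rectangle \<open>[x1, x2] \<times> [0, y]\<close>, and adding the mass
of \<open>[x1, x2] \<times> [y, 1]\<close> gives \<open>x2 - x1\<close>.
\<close>

lemma copula_imp_quasi_copula:
  assumes "copula F"
  shows "quasi_copula F"
proof -
  have G: "grounded F" and U: "uniform_marginals F" and T: "two_increasing F"
    using assms by (auto simp: copula_def)
  have bd: "F x 0 = 0" "F 0 x = 0" "F x 1 = x" "F 1 x = x" if "x \<in> {0..1}" for x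
    using G U that by (auto simp: grounded_def uniform_marginals_def)
  have V: "F x2 y2 + F x1 y1 - F x2 y1 - F x1 y2 \<ge> 0"
    if "0 \<le> x1" "x1 \<le> x2" "x2 \<le> 1" "0 \<le> y1" "y1 \<le> y2" "y2 \<le> 1" for x1 x2 y1 y2
    using T that unfolding two_increasing_def by blast
  show ?thesis
  proof (rule quasi_copulaI)
    show "F x2 y - F x1 y \<in> {0..x2 - x1}"
      if "0 \<le> x1" "x1 \<le> x2" "x2 \<le> 1" "y \<in> {0..1}" for x1 x2 y
      using V[of x1 x2 0 y] V[of x1 x2 y 1] bd[of x1] bd[of x2] that by auto
    show "F x y2 - F x y1 \<in> {0..y2 - y1}"
      if "0 \<le> y1" "y1 \<le> y2" "y2 \<le> 1" "x \<in> {0..1}" for x y1 y2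
      using V[of 0 x y1 y2] V[of x 1 y1 y2] bd[of y1] bd[of y2] that by auto
  qed (use bd in auto)
qed

lemma quasi_copula_convex_combination:
  assumes F: "quasi_copula F" and G: "quasi_copula G" and "0 \<le> a" "0 \<le> b" "a + b = 1"
  shows "quasi_copula (\<lambda>x y. a * F x y + b * G x y)"
proof (rule quasi_copulaI)
  note f = quasi_copulaD[OF F] and g = quasi_copulaD[OF G]
  have comb: "(a * p + b * q) - (a * r + b * s) \<in> {0..t}"
    if "p - r \<in> {0..t}" "q - s \<in> {0..t}" for p q r s t :: real
  proof -
    have "(a * p + b * q) - (a * r + b * s) = a * (p - r) + b * (q - s)"
      by (simp add: algebra_simps)
    moreover have "a * (p - r) \<le> a * t" "b * (q - s) \<le> b * t"
      "0 \<le> a * (p - r)" "0 \<le> b * (q - s)"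
      using that assms by (auto intro: mult_left_mono)
    moreover have "a * t + b * t = t"
      using assms(5) by (metis distrib_right mult_1)
    ultimately show ?thesis by auto
  qed
  have same: "a * t + b * t = t" for t
    using assms(5) by (metis distrib_right mult_1)
  show "a * F x2 y + b * G x2 y - (a * F x1 y + b * G x1 y) \<in> {0..x2 - x1}"
    if "0 \<le> x1" "x1 \<le> x2" "x2 \<le> 1" "y \<in> {0..1}" for x1 x2 y
    by (intro comb f g that)
  show "a * F x y2 + b * G x y2 - (a * F x y1 + b * G x y1) \<in> {0..y2 - y1}"
    if "0 \<le> y1" "y1 \<le> y2" "y2 \<le> 1" "x \<in> {0..1}" for x y1 y2
    by (intro comb f g that)
qed (use quasi_copulaD[OF F] quasi_copulaD[OF G] assms(5)
      in \<open>auto simp: distrib_right[symmetric]\<close>)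

lemma quasi_copula_average:
  assumes "\<And>i. i \<le> j \<Longrightarrow> quasi_copula (R i)"
  shows "quasi_copula (\<lambda>x y. (\<Sum>i\<le>j. R i x y) / real (Suc j))"
  using assms
proof (induction j)
  case (Suc j)
  have "quasi_copula (\<lambda>x y. real (Suc j) / real (Suc (Suc j)) * ((\<Sum>i\<le>j. R i x y) / real (Suc j))
      + 1 / real (Suc (Suc j)) * R (Suc j) x y)"
    by (rule quasi_copula_convex_combination) (use Suc in \<open>auto simp: field_simps\<close>)
  moreover have "real (Suc j) / real (Suc (Suc j)) * (a / real (Suc j)) + 1 / real (Suc (Suc j)) * b
      = (a + b) / real (Suc (Suc j))" for a b
    by (simp add: add_divide_distrib del: of_nat_Suc)
  ultimately show ?case by simp
qed auto

lemma product_copula: "copula (\<lambda>x y. x * y)"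
proof -
  have "0 \<le> (x2 - x1) * (y2 - y1)" if "x1 \<le> x2" "y1 \<le> y2" for x1 x2 y1 y2 :: real
    using that by simp
  then have "two_increasing (\<lambda>x y. x * y)"
    unfolding two_increasing_def by (simp add: algebra_simps)
  then show ?thesis
    unfolding copula_def maps_unit_square_def grounded_def uniform_marginals_def
    by (auto simp: mult_le_one)
qed

text \<open>
The source of all copulas in the series other than the product copula: \<open>M\<close> compensates the negative
mass of \<open>F\<close>, and the division restores the marginals.
\<close>

lemma copula_if_two_increasing_plus_product:
  assumes "quasi_copula F" "0 \<le> M" "two_increasing (\<lambda>x y. F x y + M * (x * y))"
  shows "copula (\<lambda>x y. (F x y + M * (x * y)) / (1 + M))"
proof -
  have "quasi_copula (\<lambda>x y. 1 / (1 + M) * F x y + M / (1 + M) * (x * y))"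
    using assms(1,2) copula_imp_quasi_copula[OF product_copula]
    by (intro quasi_copula_convex_combination) (auto simp: field_simps)
  then have "quasi_copula (\<lambda>x y. (F x y + M * (x * y)) / (1 + M))"
    by (simp add: add_divide_distrib)
  moreover have "two_increasing (\<lambda>x y. (F x y + M * (x * y)) / (1 + M))"
    unfolding two_increasing_def
  proof (intro allI impI)
    fix x1 x2 y1 y2 :: real
    assume "0 \<le> x1 \<and> x1 \<le> x2 \<and> x2 \<le> 1 \<and> 0 \<le> y1 \<and> y1 \<le> y2 \<and> y2 \<le> 1"
    then have "0 \<le> ((F x2 y2 + M * (x2 * y2)) + (F x1 y1 + M * (x1 * y1))
        - (F x2 y1 + M * (x2 * y1)) - (F x1 y2 + M * (x1 * y2))) / (1 + M)"
      using assms(2,3) unfolding two_increasing_def by (intro divide_nonneg_nonneg) auto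
    then show "0 \<le> (F x2 y2 + M * (x2 * y2)) / (1 + M) + (F x1 y1 + M * (x1 * y1)) / (1 + M)
        - (F x2 y1 + M * (x2 * y1)) / (1 + M) - (F x1 y2 + M * (x1 * y2)) / (1 + M)"
      by (simp add: add_divide_distrib diff_divide_distrib)
  qed
  ultimately show ?thesis by (auto simp: copula_def quasi_copula_def)
qed

section \<open>Piecewise linear interpolation on a uniform grid\<close>

text \<open>
The ramp rises from \<open>0\<close> to \<open>1\<close> over the \<open>i\<close>-th cell \<open>[i/n, (i+1)/n]\<close>. Interpolants are written with
ramps weighted by increments, rather than with hat functions weighted by values, because the ramps
are monotone: the signs of the weights then decide monotonicity and the 2-increasing property.
\<close>

definition ramp :: "nat \<Rightarrow> nat \<Rightarrow> real \<Rightarrow> real" where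
  "ramp n i x = max 0 (min 1 (real n * x - real i))"

lemma ramp_nonneg: "0 \<le> ramp n i x" and ramp_le_1: "ramp n i x \<le> 1"
  by (auto simp: ramp_def)

lemma ramp_mono: "x1 \<le> x2 \<Longrightarrow> ramp n i x1 \<le> ramp n i x2"
  unfolding ramp_def using mult_left_mono[of x1 x2 "real n"] by auto

lemma ramp_Suc_le: "ramp n (Suc i) x \<le> ramp n i x"
  by (auto simp: ramp_def)

lemma ramp_0: "ramp n i 0 = 0"
  by (auto simp: ramp_def)

lemma ramp_at_node: "n > 0 \<Longrightarrow> ramp n i (real k / real n) = (if i < k then 1 else 0)"
  by (auto simp: ramp_def)

lemma sum_ramp_aux:
  assumes "0 \<le> x"
  shows "(\<Sum>i<m. ramp n i x) = min (real n * x) (real m)"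
  using assms by (induction m) (auto simp: ramp_def)

lemma sum_ramp:
  assumes "x \<in> {0..1}"
  shows "(\<Sum>i<n. ramp n i x) = real n * x"
  using assms sum_ramp_aux[of x n n] mult_left_mono[of x 1 "real n"] by auto

lemma sum_ramp_at_node:
  assumes "n > 0" "k \<le> n"
  shows "(\<Sum>i<n. a i * ramp n i (real k / real n)) = (\<Sum>i<k. a i)"
proof -
  have "(\<Sum>i<n. a i * ramp n i (real k / real n)) = (\<Sum>i\<in>{..<n}. if i \<in> {..<k} then a i else 0)"
    using assms(1) by (intro sum.cong) (auto simp: ramp_at_node)
  also have "\<dots> = (\<Sum>i\<in>{..<n} \<inter> {..<k}. a i)"
    by (rule sum.inter_restrict[symmetric]) simp
  also have "{..<n} \<inter> {..<k} = {..<k}" using assms(2) by auto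
  finally show ?thesis .
qed

text \<open>
The sum is the piecewise linear interpolant of the values \<open>g 0, \<dots>, g n\<close>, so it stays within their
bounds. Summation by parts exhibits it as a combination of the \<open>g j\<close> with nonnegative weights, of
total at most \<open>1\<close> as the ramps decrease in \<open>j\<close>.
\<close>

lemma sum_increments_ramp_bounds:
  assumes g0: "g 0 = 0" and g: "\<And>j. j \<le> n \<Longrightarrow> g j \<in> {0..B}"
  shows "(\<Sum>j<n. (g (Suc j) - g j) * ramp n j y) \<in> {0..B}"
proof -
  let ?w = "\<lambda>j. ramp n j y"
  have abel: "(\<Sum>j<m. (g (Suc j) - g j) * ?w j) =
      g m * ?w m + (\<Sum>j<m. g (Suc j) * (?w j - ?w (Suc j)))" for m
    by (induction m) (auto simp: g0 algebra_simps)
  have "0 \<le> g n * ?w n" "g n * ?w n \<le> B * ?w n"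
    using g[of n] ramp_nonneg by (auto intro: mult_right_mono)
  moreover have "0 \<le> (\<Sum>j<n. g (Suc j) * (?w j - ?w (Suc j)))"
    using g ramp_Suc_le by (intro sum_nonneg mult_nonneg_nonneg) (auto simp: Suc_le_eq)
  moreover have "(\<Sum>j<n. g (Suc j) * (?w j - ?w (Suc j))) \<le> (\<Sum>j<n. B * (?w j - ?w (Suc j)))"
    using g ramp_Suc_le by (intro sum_mono mult_right_mono) (auto simp: Suc_le_eq)
  moreover have "(\<Sum>j<n. B * (?w j - ?w (Suc j))) = B * (?w 0 - ?w n)"
    by (simp only: sum_distrib_left[symmetric] sum_lessThan_telescope'[of ?w])
  moreover have "B * ?w 0 \<le> B"
    using g[of 0] ramp_nonneg[of n 0 y] ramp_le_1[of n 0 y] mult_left_mono[of "?w 0" 1 B] by auto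
  ultimately show ?thesis
    unfolding abel by (auto simp: algebra_simps)
qed

text \<open>
The volume is bracketed as the increment in \<open>j\<close> of the mass of a vertical strip, so that sums over
\<open>j\<close> telescope.
\<close>

definition cell_volume :: "(real \<Rightarrow> real \<Rightarrow> real) \<Rightarrow> nat \<Rightarrow> nat \<Rightarrow> nat \<Rightarrow> real" where
  "cell_volume Q n i j =
     (Q (real (Suc i) / real n) (real (Suc j) / real n) - Q (real i / real n) (real (Suc j) / real n))
   - (Q (real (Suc i) / real n) (real j / real n) - Q (real i / real n) (real j / real n))"

definition bilinear_interpolant :: "(real \<Rightarrow> real \<Rightarrow> real) \<Rightarrow> nat \<Rightarrow> real \<Rightarrow> real \<Rightarrow> real" where
  "bilinear_interpolant Q n x y =
     (\<Sum>i<n. \<Sum>j<n. cell_volume Q n i j * ramp n i x * ramp n j y)"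

lemma bilinear_interpolant_transpose:
  "bilinear_interpolant Q n x y = bilinear_interpolant (\<lambda>x y. Q y x) n y x"
  unfolding bilinear_interpolant_def cell_volume_def
  by (subst sum.swap) (simp add: algebra_simps)

lemma bilinear_interpolant_rows:
  "bilinear_interpolant Q n x y =
     (\<Sum>i<n. (\<Sum>j<n. cell_volume Q n i j * ramp n j y) * ramp n i x)"
  unfolding bilinear_interpolant_def by (simp add: sum_distrib_left mult_ac)

lemma strip_increment_bounds:
  assumes "quasi_copula Q" "n > 0" "i < n" "j \<le> n"
  shows "Q (real (Suc i) / real n) (real j / real n) - Q (real i / real n) (real j / real n)
    \<in> {0..1 / real n}"
proof -
  have "real (Suc i) / real n - real i / real n = 1 / real n"
    by (simp add: diff_divide_distrib[symmetric])
  then show ?thesis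
    using quasi_copulaD(5)[OF assms(1), of "real i / real n" "real (Suc i) / real n" "real j / real n"]
      assms(2-4) by (auto simp: divide_right_mono)
qed

text \<open>
A cell volume is a difference of two strip increments from \<open>[0, 1/n]\<close>. The bound is of the order of
the cell width, not of its area, so the density of the interpolant is bounded below by \<open>-n\<close> only;
this is what forces the grids to be refined slowly.
\<close>

lemma cell_volume_ge:
  assumes "quasi_copula Q" "n > 0" "i < n" "j < n"
  shows "cell_volume Q n i j \<ge> - 1 / real n"
  using strip_increment_bounds[OF assms(1-3), of j] strip_increment_bounds[OF assms(1-3), of "Suc j"]
    assms(4) unfolding cell_volume_def by auto

text \<open>
Up to the factor \<open>n\<close>, the row sum is the slope of the interpolant in \<open>x\<close> on the \<open>i\<close>-th strip; it
interpolates the strip increments and hence inherits their bounds. Monotonicity and the Lipschitz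
condition of the interpolant both rest on this.
\<close>

lemma row_sum_bounds:
  assumes "quasi_copula Q" "n > 0" "i < n"
  shows "(\<Sum>j<n. cell_volume Q n i j * ramp n j y) \<in> {0..1 / real n}"
  unfolding cell_volume_def
proof (rule sum_increments_ramp_bounds)
  show "Q (real (Suc i) / real n) (real 0 / real n) - Q (real i / real n) (real 0 / real n) = 0"
    using quasi_copulaD(1)[OF assms(1)] assms(2,3) by simp
qed (rule strip_increment_bounds[OF assms])

lemma bilinear_interpolant_at_node:
  assumes "quasi_copula Q" "n > 0" "k \<le> n" "l \<le> n"
  shows "bilinear_interpolant Q n (real k / real n) (real l / real n) =
    Q (real k / real n) (real l / real n)"
proof -
  note q = quasi_copulaD[OF assms(1)]
  define h where "h i j = Q (real i / real n) (real j / real n)" for i j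
  have h0: "h i 0 = 0" "h 0 i = 0" if "i \<le> n" for i
    using q(1,2) that assms(2) by (auto simp: h_def)
  have "(\<Sum>i<n. \<Sum>j<n. cell_volume Q n i j * ramp n i (real k / real n) * ramp n j (real l / real n))
      = (\<Sum>i<n. (\<Sum>j<l. cell_volume Q n i j) * ramp n i (real k / real n))"
    unfolding sum_ramp_at_node[OF assms(2,4), symmetric]
    by (simp add: sum_distrib_left mult_ac)
  also have "\<dots> = (\<Sum>i<k. \<Sum>j<l. cell_volume Q n i j)"
    by (rule sum_ramp_at_node[OF assms(2,3)])
  also have "\<dots> = (\<Sum>i<k. \<Sum>j<l. (h (Suc i) (Suc j) - h i (Suc j)) - (h (Suc i) j - h i j))"
    by (simp add: cell_volume_def h_def)
  also have "\<dots> = (\<Sum>i<k. (h (Suc i) l - h i l) - (h (Suc i) 0 - h i 0))"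
    by (intro sum.cong refl sum_lessThan_telescope)
  also have "\<dots> = (\<Sum>i<k. h (Suc i) l - h i l)"
    using assms(3) by (intro sum.cong) (auto simp: h0)
  also have "\<dots> = h k l"
    using assms(4) by (simp add: sum_lessThan_telescope[of "\<lambda>i. h i l"] h0)
  finally show ?thesis by (simp add: bilinear_interpolant_def h_def)
qed

lemma bilinear_interpolant_increment:
  assumes "quasi_copula Q" "n > 0" "0 \<le> x1" "x1 \<le> x2" "x2 \<le> 1"
  shows "bilinear_interpolant Q n x2 y - bilinear_interpolant Q n x1 y \<in> {0..x2 - x1}"
proof -
  let ?s = "\<lambda>i. \<Sum>j<n. cell_volume Q n i j * ramp n j y"
  have eq: "bilinear_interpolant Q n x2 y - bilinear_interpolant Q n x1 y
      = (\<Sum>i<n. ?s i * (ramp n i x2 - ramp n i x1))"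
    by (simp add: bilinear_interpolant_rows sum_subtractf right_diff_distrib)
  have "0 \<le> ?s i * (ramp n i x2 - ramp n i x1)" if "i < n" for i
    using row_sum_bounds[OF assms(1,2) that] ramp_mono[OF assms(4)]
    by (intro mult_nonneg_nonneg) auto
  then have "0 \<le> (\<Sum>i<n. ?s i * (ramp n i x2 - ramp n i x1))"
    by (intro sum_nonneg) auto
  moreover have "(\<Sum>i<n. ?s i * (ramp n i x2 - ramp n i x1))
      \<le> (\<Sum>i<n. 1 / real n * (ramp n i x2 - ramp n i x1))"
    using row_sum_bounds[OF assms(1,2)] ramp_mono[OF assms(4)]
    by (intro sum_mono mult_right_mono) auto
  moreover have "(\<Sum>i<n. 1 / real n * (ramp n i x2 - ramp n i x1)) = x2 - x1"
    unfolding sum_distrib_left[symmetric] sum_subtractf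
    using assms(2-5) by (simp add: sum_ramp field_simps)
  ultimately show ?thesis unfolding eq by simp
qed

lemma bilinear_interpolant_marginal:
  assumes "quasi_copula Q" "n > 0" "x \<in> {0..1}"
  shows "bilinear_interpolant Q n x 1 = x"
proof -
  note q = quasi_copulaD[OF assms(1)]
  have "(\<Sum>j<n. cell_volume Q n i j * ramp n j 1) = 1 / real n" if "i < n" for i
  proof -
    have "(\<Sum>j<n. cell_volume Q n i j * ramp n j (real n / real n)) = (\<Sum>j<n. cell_volume Q n i j)"
      by (rule sum_ramp_at_node[OF assms(2) order_refl])
    also have "\<dots> = (Q (real (Suc i) / real n) (real n / real n) - Q (real i / real n) (real n / real n))
        - (Q (real (Suc i) / real n) (real 0 / real n) - Q (real i / real n) (real 0 / real n))"
      unfolding cell_volume_def by (rule sum_lessThan_telescope)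
    also have "\<dots> = 1 / real n"
      using that assms(2) q(1)[of "real (Suc i) / real n"] q(1)[of "real i / real n"]
        q(3)[of "real (Suc i) / real n"] q(3)[of "real i / real n"]
      by (simp add: diff_divide_distrib[symmetric])
    finally show ?thesis using assms(2) by simp
  qed
  then have "bilinear_interpolant Q n x 1 = (\<Sum>i<n. 1 / real n * ramp n i x)"
    unfolding bilinear_interpolant_rows by (intro sum.cong) auto
  also have "\<dots> = x"
    unfolding sum_distrib_left[symmetric] using assms by (simp add: sum_ramp)
  finally show ?thesis .
qed

lemma quasi_copula_bilinear_interpolant:
  assumes "quasi_copula Q" "n > 0"
  shows "quasi_copula (bilinear_interpolant Q n)"
proof (rule quasi_copulaI)
  note Qt = quasi_copula_transpose[OF assms(1)]
  show "bilinear_interpolant Q n x 0 = 0" "bilinear_interpolant Q n 0 y = 0" for x y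
    by (auto simp: bilinear_interpolant_def ramp_0)
  show "bilinear_interpolant Q n x 1 = x" if "x \<in> {0..1}" for x
    using bilinear_interpolant_marginal[OF assms that] .
  show "bilinear_interpolant Q n 1 y = y" if "y \<in> {0..1}" for y
    using bilinear_interpolant_marginal[OF Qt assms(2) that]
      bilinear_interpolant_transpose[of Q n 1 y] by simp
  show "bilinear_interpolant Q n x2 y - bilinear_interpolant Q n x1 y \<in> {0..x2 - x1}"
    if "0 \<le> x1" "x1 \<le> x2" "x2 \<le> 1" for x1 x2 y
    using bilinear_interpolant_increment[OF assms that] .
  show "bilinear_interpolant Q n x y2 - bilinear_interpolant Q n x y1 \<in> {0..y2 - y1}"
    if "0 \<le> y1" "y1 \<le> y2" "y2 \<le> 1" for x y1 y2
    using bilinear_interpolant_increment[OF Qt assms(2) that, of x]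
      bilinear_interpolant_transpose[of Q n x] by simp
qed

text \<open>
Expanding \<open>n xy\<close> in the same ramps adds \<open>1/n\<close> to each cell volume, which makes all coefficients
nonnegative; products of monotone ramps are 2-increasing.
\<close>

lemma two_increasing_interpolant_plus_product:
  assumes "quasi_copula Q" "n > 0"
  shows "two_increasing (\<lambda>x y. bilinear_interpolant Q n x y + real n * (x * y))"
  unfolding two_increasing_def
proof (intro allI impI)
  fix x1 x2 y1 y2 :: real
  assume *: "0 \<le> x1 \<and> x1 \<le> x2 \<and> x2 \<le> 1 \<and> 0 \<le> y1 \<and> y1 \<le> y2 \<and> y2 \<le> 1"
  then have x: "x1 \<in> {0..1}" "x2 \<in> {0..1}" and y: "y1 \<in> {0..1}" "y2 \<in> {0..1}" by auto
  let ?F = "\<lambda>x y. bilinear_interpolant Q n x y + real n * (x * y)"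
  have F: "?F x y = (\<Sum>i<n. \<Sum>j<n. (cell_volume Q n i j + 1 / real n) * (ramp n i x * ramp n j y))"
    if "x \<in> {0..1}" "y \<in> {0..1}" for x y
  proof -
    have "(\<Sum>i<n. \<Sum>j<n. 1 / real n * (ramp n i x * ramp n j y))
        = 1 / real n * ((\<Sum>i<n. ramp n i x) * (\<Sum>j<n. ramp n j y))"
      by (subst sum_product) (simp only: sum_distrib_left)
    also have "\<dots> = real n * (x * y)"
      using that assms(2) by (simp add: sum_ramp)
    finally show ?thesis
      by (simp add: bilinear_interpolant_def distrib_right sum.distrib mult.assoc)
  qed
  have "?F x2 y2 + ?F x1 y1 - ?F x2 y1 - ?F x1 y2 = (\<Sum>i<n. \<Sum>j<n.
      (cell_volume Q n i j + 1 / real n) *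
        ((ramp n i x2 - ramp n i x1) * (ramp n j y2 - ramp n j y1)))"
    unfolding F[OF x(1) y(1)] F[OF x(1) y(2)] F[OF x(2) y(1)] F[OF x(2) y(2)]
      sum.distrib[symmetric] sum_subtractf[symmetric]
    by (intro sum.cong refl) (simp add: algebra_simps)
  also have "\<dots> \<ge> 0"
  proof (intro sum_nonneg mult_nonneg_nonneg)
    fix i j assume "i \<in> {..<n}" "j \<in> {..<n}"
    then show "0 \<le> cell_volume Q n i j + 1 / real n"
      using cell_volume_ge[OF assms, of i j] by simp
    show "0 \<le> ramp n i x2 - ramp n i x1" "0 \<le> ramp n j y2 - ramp n j y1"
      using * ramp_mono[of x1 x2 n i] ramp_mono[of y1 y2 n j] by auto
  qed
  finally show "0 \<le> ?F x2 y2 + ?F x1 y1 - ?F x2 y1 - ?F x1 y2" .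
qed

text \<open>
Both functions are 1-Lipschitz and they agree at the grid nodes, one of which is within \<open>1/n\<close> of the
given point in each coordinate.
\<close>

lemma bilinear_interpolant_error:
  assumes Q: "quasi_copula Q" and n: "n > 0" and "x \<in> {0..1}" "y \<in> {0..1}"
  shows "\<bar>bilinear_interpolant Q n x y - Q x y\<bar> \<le> 4 / real n"
proof -
  have node: "\<exists>k\<le>n. \<bar>z - real k / real n\<bar> \<le> 1 / real n" if "z \<in> {0..1}" for z
  proof (intro exI conjI)
    let ?k = "nat \<lfloor>real n * z\<rfloor>"
    have nz: "0 \<le> real n * z" "real n * z \<le> real n"
      using that mult_left_mono[of z 1 "real n"] by auto
    then show "?k \<le> n" by linarith
    have "\<bar>real n * z - real ?k\<bar> \<le> 1" using nz by linarith
    moreover have "z - real ?k / real n = (real n * z - real ?k) / real n"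
      using n by (simp add: field_simps)
    ultimately show "\<bar>z - real ?k / real n\<bar> \<le> 1 / real n"
      using n by (simp add: divide_right_mono)
  qed
  obtain k where k: "k \<le> n" "\<bar>x - real k / real n\<bar> \<le> 1 / real n" using node assms(3) by blast
  obtain l where l: "l \<le> n" "\<bar>y - real l / real n\<bar> \<le> 1 / real n" using node assms(4) by blast
  have sq: "real k / real n \<in> {0..1}" "real l / real n \<in> {0..1}" using k l n by auto
  have lip: "\<bar>F x y - F (real k / real n) (real l / real n)\<bar> \<le> 2 / real n"
    if "quasi_copula F" for F
  proof -
    have "\<bar>F x y - F (real k / real n) (real l / real n)\<bar>
        \<le> \<bar>x - real k / real n\<bar> + \<bar>y - real l / real n\<bar>"
      using that sq assms(3,4) unfolding quasi_copula_def one_lipschitz_def by blast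
    then show ?thesis using k(2) l(2) by simp
  qed
  show ?thesis
    using lip[OF Q] lip[OF quasi_copula_bilinear_interpolant[OF Q n]]
      bilinear_interpolant_at_node[OF Q n k(1) l(1)] by linarith
qed

lemma bilinear_interpolant_1:
  assumes "quasi_copula Q" "x \<in> {0..1}" "y \<in> {0..1}"
  shows "bilinear_interpolant Q 1 x y = x * y"
  using assms quasi_copulaD(1-4)[OF assms(1)]
  by (simp add: bilinear_interpolant_def cell_volume_def ramp_def)

section \<open>Slow averaging\<close>

lemma two_increasing_average:
  assumes "\<And>i. i \<le> j \<Longrightarrow> two_increasing (\<lambda>x y. R i x y + M i * (x * y))"
    and "\<And>i. i \<le> j \<Longrightarrow> M i \<le> K"
  shows "two_increasing (\<lambda>x y. (\<Sum>i\<le>j. R i x y) / real (Suc j) + K * (x * y))"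
  unfolding two_increasing_def
proof (intro allI impI)
  fix x1 x2 y1 y2 :: real
  assume *: "0 \<le> x1 \<and> x1 \<le> x2 \<and> x2 \<le> 1 \<and> 0 \<le> y1 \<and> y1 \<le> y2 \<and> y2 \<le> 1"
  let ?v = "\<lambda>i. R i x2 y2 + R i x1 y1 - R i x2 y1 - R i x1 y2"
  let ?p = "(x2 - x1) * (y2 - y1)"
  have "0 \<le> ?v i + K * ?p" if "i \<le> j" for i
  proof -
    have "0 \<le> (R i x2 y2 + M i * (x2 * y2)) + (R i x1 y1 + M i * (x1 * y1))
        - (R i x2 y1 + M i * (x2 * y1)) - (R i x1 y2 + M i * (x1 * y2))"
      using assms(1)[OF that] * unfolding two_increasing_def by blast
    moreover have "M i * ?p \<le> K * ?p"
      using assms(2)[OF that] * by (intro mult_right_mono) auto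
    ultimately show ?thesis by (simp add: algebra_simps)
  qed
  then have "0 \<le> (\<Sum>i\<le>j. ?v i + K * ?p) / real (Suc j)"
    by (intro divide_nonneg_nonneg sum_nonneg) auto
  also have "(\<Sum>i\<le>j. ?v i + K * ?p) = (\<Sum>i\<le>j. ?v i) + real (Suc j) * (K * ?p)"
    by (simp add: sum.distrib)
  also have "\<dots> / real (Suc j) = (\<Sum>i\<le>j. ?v i) / real (Suc j) + K * ?p"
    by (simp add: add_divide_distrib del: of_nat_Suc)
  also have "\<dots> = (\<Sum>i\<le>j. R i x2 y2) / real (Suc j) + K * (x2 * y2)
      + ((\<Sum>i\<le>j. R i x1 y1) / real (Suc j) + K * (x1 * y1))
      - ((\<Sum>i\<le>j. R i x2 y1) / real (Suc j) + K * (x2 * y1))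
      - ((\<Sum>i\<le>j. R i x1 y2) / real (Suc j) + K * (x1 * y2))"
    by (simp add: sum.distrib sum_subtractf add_divide_distrib diff_divide_distrib algebra_simps
        del: of_nat_Suc)
  finally show "0 \<le> (\<Sum>i\<le>j. R i x2 y2) / real (Suc j) + K * (x2 * y2)
      + ((\<Sum>i\<le>j. R i x1 y1) / real (Suc j) + K * (x1 * y1))
      - ((\<Sum>i\<le>j. R i x2 y1) / real (Suc j) + K * (x2 * y1))
      - ((\<Sum>i\<le>j. R i x1 y2) / real (Suc j) + K * (x1 * y2))" .
qed

lemma sum_inverse_sqrt_le: "(\<Sum>i\<le>j. 1 / sqrt (real (Suc i))) \<le> 2 * sqrt (real (Suc j))"
proof (induction j)
  case (Suc j)
  define a b where "a = sqrt (real (Suc j))" and "b = sqrt (real (Suc (Suc j)))"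
  have ab: "0 < a" "a \<le> b" "b\<^sup>2 = a\<^sup>2 + 1" by (auto simp: a_def b_def)
  have "1 = (b - a) * (b + a)" using ab(3) by (simp add: algebra_simps power2_eq_square)
  also have "\<dots> \<le> (b - a) * (2 * b)" using ab by (intro mult_left_mono) auto
  finally have "1 / b \<le> 2 * b - 2 * a" using ab by (simp add: field_simps)
  then show ?case using Suc by (simp add: a_def b_def)
qed auto

text \<open>
The growth rate \<open>\<surd>i\<close> balances two needs: the number of subdivisions divided by \<open>i\<close> must tend to \<open>0\<close>,
as it governs the size of the steps between averages, and it must itself tend to infinity for the
interpolants to converge.
\<close>

definition slow_grid :: "nat \<Rightarrow> nat" where
  "slow_grid i = nat \<lceil>sqrt (real (Suc i))\<rceil>"

lemma slow_grid_bounds: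
  "sqrt (real (Suc i)) \<le> real (slow_grid i)" "real (slow_grid i) \<le> sqrt (real (Suc i)) + 1"
  using le_of_int_ceiling[of "sqrt (real (Suc i))"] of_int_ceiling_le_add_one[of "sqrt (real (Suc i))"]
  by (simp_all add: slow_grid_def)

lemma slow_grid_pos: "slow_grid i > 0"
  unfolding slow_grid_def by simp

lemma slow_grid_mono: "i \<le> j \<Longrightarrow> slow_grid i \<le> slow_grid j"
  unfolding slow_grid_def by (intro nat_mono ceiling_mono) simp

definition slow_average :: "(real \<Rightarrow> real \<Rightarrow> real) \<Rightarrow> nat \<Rightarrow> real \<Rightarrow> real \<Rightarrow> real" where
  "slow_average Q j x y = (\<Sum>i\<le>j. bilinear_interpolant Q (slow_grid i) x y) / real (Suc j)"

lemma slow_average_error: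
  assumes "quasi_copula Q" "x \<in> {0..1}" "y \<in> {0..1}"
  shows "\<bar>slow_average Q j x y - Q x y\<bar> \<le> 8 / sqrt (real (Suc j))"
proof -
  let ?R = "\<lambda>i. bilinear_interpolant Q (slow_grid i) x y"
  have err: "\<bar>?R i - Q x y\<bar> \<le> 4 * (1 / sqrt (real (Suc i)))" for i
  proof -
    have "\<bar>?R i - Q x y\<bar> \<le> 4 / real (slow_grid i)"
      by (rule bilinear_interpolant_error[OF assms(1) slow_grid_pos assms(2,3)])
    also have "\<dots> \<le> 4 / sqrt (real (Suc i))"
      by (intro divide_left_mono slow_grid_bounds) (auto simp: slow_grid_pos)
    finally show ?thesis by simp
  qed
  have "slow_average Q j x y - Q x y = (\<Sum>i\<le>j. ?R i - Q x y) / real (Suc j)"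
    by (simp add: slow_average_def sum_subtractf field_simps)
  also have "\<bar>\<dots>\<bar> \<le> (\<Sum>i\<le>j. 4 * (1 / sqrt (real (Suc i)))) / real (Suc j)"
    unfolding abs_divide using err by (auto intro!: divide_right_mono order.trans[OF sum_abs] sum_mono)
  also have "\<dots> \<le> 8 * sqrt (real (Suc j)) / real (Suc j)"
    unfolding sum_distrib_left[symmetric]
    using sum_inverse_sqrt_le[of j] by (intro divide_right_mono) auto
  also have "\<dots> = 8 / sqrt (real (Suc j))"
    using sqrt_divide_self_eq[of "real (Suc j)"]
    by (simp add: divide_inverse mult.assoc del: of_nat_Suc)
  finally show ?thesis .
qed

section \<open>From small steps to a series\<close>

text \<open>
The terms are \<open>C0, \<epsilon> 0 * P 0, - \<epsilon> 0 * N 0, \<epsilon> 1 * P 1, - \<epsilon> 1 * N 1, \<dots>\<close>. The partial sums pass through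
every \<open>T j\<close>, and between two of them they deviate by at most \<open>\<epsilon> j\<close> because \<open>P j\<close> takes values in
\<open>[0, 1]\<close>.
\<close>

lemma series_from_small_copula_steps:
  assumes C0: "copula C0" "\<And>x y. x \<in> {0..1} \<Longrightarrow> y \<in> {0..1} \<Longrightarrow> T 0 x y = C0 x y"
    and T: "\<And>j. quasi_copula (T j)" and P: "\<And>j. copula (P j)" and N: "\<And>j. copula (N j)"
    and step: "\<And>j x y. x \<in> {0..1} \<Longrightarrow> y \<in> {0..1} \<Longrightarrow>
      T (Suc j) x y = T j x y + \<epsilon> j * P j x y - \<epsilon> j * N j x y"
    and eps: "\<And>j. 0 \<le> \<epsilon> j" "\<epsilon> \<longlonglongrightarrow> 0"
    and err: "\<And>j x y. x \<in> {0..1} \<Longrightarrow> y \<in> {0..1} \<Longrightarrow> \<bar>T j x y - Q x y\<bar> \<le> e j" "e \<longlonglongrightarrow> 0"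
  shows "\<exists>(C :: nat \<Rightarrow> real \<Rightarrow> real \<Rightarrow> real) (\<gamma> :: nat \<Rightarrow> real).
    (\<forall>j. copula (C j)) \<and>
    uniform_limit ({0..1} \<times> {0..1})
      (\<lambda>N (x, y). \<Sum>j=1..N. \<gamma> j * C j x y) (\<lambda>(x, y). Q x y) sequentially \<and>
    (\<forall>N\<ge>1. \<exists>c>0. \<exists>Q'. quasi_copula Q' \<and>
       (\<forall>x\<in>{0..1}. \<forall>y\<in>{0..1}. (\<Sum>j=1..N. \<gamma> j * C j x y) = c * Q' x y))"
proof -
  \<comment> \<open>Indices start at 1; index 0 is never summed and only receives a copula so that all \<open>C k\<close> are
    copulas. For \<open>k \<ge> 2\<close>, \<open>P j\<close> sits at \<open>k = 2 j + 2\<close> and \<open>N j\<close> at \<open>k = 2 j + 3\<close>.\<close>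
  define C where "C k = (if k \<le> 1 then C0 else if even k then P (k div 2 - 1) else N (k div 2 - 1))" for k
  define \<gamma> where "\<gamma> k = (if k \<le> 1 then 1 else if even k then \<epsilon> (k div 2 - 1) else - \<epsilon> (k div 2 - 1))"
    for k :: nat
  let ?S = "\<lambda>N x y. \<Sum>j=1..N. \<gamma> j * C j x y"
  have odd_sum: "?S (Suc (2 * j)) x y = T j x y" if "x \<in> {0..1}" "y \<in> {0..1}" for j x y
  proof (induction j)
    case 0
    then show ?case using C0(2)[OF that] by (simp add: C_def \<gamma>_def)
  next
    case (Suc j)
    then show ?case using step[OF that, of j] by (simp add: C_def \<gamma>_def)
  qed
  have even_sum: "?S (Suc (Suc (2 * j))) x y = T j x y + \<epsilon> j * P j x y"
    if "x \<in> {0..1}" "y \<in> {0..1}" for j x y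
    using odd_sum[OF that, of j] by (simp add: C_def \<gamma>_def)
  have cases_N: "\<exists>j. N = Suc (2 * j) \<or> N = Suc (Suc (2 * j))" if "N \<ge> 1" for N :: nat
    using that by presburger
  show ?thesis
  proof (intro exI[of _ C] exI[of _ \<gamma>] conjI allI impI)
    show "copula (C j)" for j using C0(1) P N by (simp add: C_def)
    have bound: "\<bar>?S N x y - Q x y\<bar> \<le> e ((N - 1) div 2) + \<epsilon> ((N - 1) div 2)"
      if N: "N \<ge> 1" and xy: "x \<in> {0..1}" "y \<in> {0..1}" for N x y
    proof -
      obtain j where j: "N = Suc (2 * j) \<or> N = Suc (Suc (2 * j))" using cases_N[OF N] by blast
      have "P j x y \<in> {0..1}"
        using P[of j] xy by (auto simp: copula_def maps_unit_square_def)
      then have "0 \<le> \<epsilon> j * P j x y" "\<epsilon> j * P j x y \<le> \<epsilon> j"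
        using eps(1)[of j] by (auto intro: mult_left_le)
      then show ?thesis
        using j odd_sum[OF xy, of j] even_sum[OF xy, of j] err(1)[OF xy, of j] eps(1)[of j] by auto
    qed
    have "filterlim (\<lambda>N::nat. (N - 1) div 2) at_top sequentially"
      unfolding filterlim_at_top
    proof
      fix Z :: nat
      show "\<forall>\<^sub>F N in sequentially. Z \<le> (N - 1) div 2"
        using eventually_ge_at_top[of "2 * Z + 1"] by eventually_elim auto
    qed
    from filterlim_compose[OF tendsto_add[OF err(2) eps(2)] this]
    have lim: "(\<lambda>N. e ((N - 1) div 2) + \<epsilon> ((N - 1) div 2)) \<longlonglongrightarrow> 0" by simp
    show "uniform_limit ({0..1} \<times> {0..1}) (\<lambda>N (x, y). ?S N x y) (\<lambda>(x, y). Q x y) sequentially"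
    proof (rule uniform_limitI)
      fix d :: real assume "d > 0"
      with lim have "\<forall>\<^sub>F N in sequentially. e ((N - 1) div 2) + \<epsilon> ((N - 1) div 2) < d"
        by (rule order_tendstoD)
      then show "\<forall>\<^sub>F N in sequentially. \<forall>z\<in>{0..1} \<times> {0..1}.
          dist (case z of (x, y) \<Rightarrow> ?S N x y) (case z of (x, y) \<Rightarrow> Q x y) < d"
        using eventually_ge_at_top[of 1]
      proof eventually_elim
        case (elim N)
        show ?case
          using bound[OF elim(2)] elim(1) by (force simp: dist_real_def)
      qed
    qed
    show "\<exists>c>0. \<exists>Q'. quasi_copula Q' \<and> (\<forall>x\<in>{0..1}. \<forall>y\<in>{0..1}. ?S N x y = c * Q' x y)"
      if N: "N \<ge> 1" for N
    proof -
      obtain j where "N = Suc (2 * j) \<or> N = Suc (Suc (2 * j))" using cases_N[OF N] by blast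
      then show ?thesis
      proof
        assume "N = Suc (2 * j)"
        then show ?thesis using odd_sum[of _ _ j] T[of j]
          by (intro exI[of _ 1] conjI exI[of _ "T j"]) auto
      next
        assume Nj: "N = Suc (Suc (2 * j))"
        let ?G = "\<lambda>x y. 1 / (1 + \<epsilon> j) * T j x y + \<epsilon> j / (1 + \<epsilon> j) * P j x y"
        have pos: "1 + \<epsilon> j > 0" using eps(1)[of j] by linarith
        have "quasi_copula ?G"
          using eps(1)[of j] pos
          by (intro quasi_copula_convex_combination T copula_imp_quasi_copula[OF P])
             (auto simp: add_divide_distrib[symmetric])
        moreover have "T j x y + \<epsilon> j * P j x y = (1 + \<epsilon> j) * ?G x y" for x y
          using pos by (simp add: distrib_left)
        ultimately show ?thesis
          using even_sum[of _ _ j] pos Nj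
          by (intro exI[of _ "1 + \<epsilon> j"] conjI exI[of _ ?G]) auto
      qed
    qed
  qed
qed

theorem theorem8:
  fixes Q :: "real \<Rightarrow> real \<Rightarrow> real"
  assumes "quasi_copula Q"
  shows "\<exists>(C :: nat \<Rightarrow> real \<Rightarrow> real \<Rightarrow> real) (\<gamma> :: nat \<Rightarrow> real).
    (\<forall>j\<ge>1. copula (C j)) \<and>
    (\<lambda>j. \<gamma> (Suc j)) sums 1 \<and>
    (\<forall>x\<in>{0..1}. \<forall>y\<in>{0..1}. (\<lambda>j. \<gamma> (Suc j) * C (Suc j) x y) sums Q x y) \<and>
    uniform_limit ({0..1} \<times> {0..1})
      (\<lambda>N (x, y). \<Sum>j=1..N. \<gamma> j * C j x y) (\<lambda>(x, y). Q x y) sequentially \<and>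
    (\<forall>N\<ge>1. \<exists>c>0. \<exists>Q'. quasi_copula Q' \<and>
       (\<forall>x\<in>{0..1}. \<forall>y\<in>{0..1}. (\<Sum>j=1..N. \<gamma> j * C j x y) = c * Q' x y))"
proof -
  define T where "T = slow_average Q"
  define R where "R j = bilinear_interpolant Q (slow_grid j)" for j
  \<comment> \<open>One constant must serve both \<open>R (Suc j)\<close> and \<open>T j\<close>, so that the product terms of \<open>P j\<close> and
    \<open>N j\<close> cancel; the finest grid involved is that of \<open>R (Suc j)\<close>.\<close>
  define m where "m j = real (slow_grid (Suc j))" for j
  define P where "P j x y = (R (Suc j) x y + m j * (x * y)) / (1 + m j)" for j x y
  define N where "N j x y = (T j x y + m j * (x * y)) / (1 + m j)" for j x y
  define \<epsilon> where "\<epsilon> j = (1 + m j) / real (Suc (Suc j))" for j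
  have R: "quasi_copula (R j)" for j
    unfolding R_def by (rule quasi_copula_bilinear_interpolant[OF assms slow_grid_pos])
  have T_avg: "T j = (\<lambda>x y. (\<Sum>i\<le>j. R i x y) / real (Suc j))" for j
    by (auto simp: T_def R_def slow_average_def fun_eq_iff)
  have T: "quasi_copula (T j)" for j
    unfolding T_avg by (rule quasi_copula_average) (rule R)
  have m_nonneg: "0 \<le> m j" for j by (simp add: m_def)
  have P: "copula (P j)" for j
    unfolding P_def using R m_nonneg two_increasing_interpolant_plus_product[OF assms slow_grid_pos]
    by (intro copula_if_two_increasing_plus_product) (auto simp: m_def R_def)
  have "two_increasing (\<lambda>x y. T j x y + m j * (x * y))" for j
    unfolding T_avg
  proof (rule two_increasing_average)
    show "two_increasing (\<lambda>x y. R i x y + real (slow_grid i) * (x * y))" for i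
      unfolding R_def by (rule two_increasing_interpolant_plus_product[OF assms slow_grid_pos])
    show "real (slow_grid i) \<le> m j" if "i \<le> j" for i
      using slow_grid_mono[of i "Suc j"] that by (simp add: m_def)
  qed
  then have N: "copula (N j)" for j
    unfolding N_def using T m_nonneg by (intro copula_if_two_increasing_plus_product)
  have step: "T (Suc j) x y = T j x y + \<epsilon> j * P j x y - \<epsilon> j * N j x y" for j x y
  proof -
    define s where "s = real (Suc j)"
    define a where "a = (\<Sum>i\<le>j. R i x y)"
    have s: "s > 0" "real (Suc (Suc j)) = s + 1" by (auto simp: s_def)
    have "\<epsilon> j * P j x y - \<epsilon> j * N j x y = (R (Suc j) x y - T j x y) / real (Suc (Suc j))"
      unfolding \<epsilon>_def P_def N_def using m_nonneg[of j]
      by (simp add: diff_divide_distrib[symmetric] del: of_nat_Suc)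
    moreover have "T (Suc j) x y = (a + R (Suc j) x y) / (s + 1)" "T j x y = a / s"
      unfolding T_avg by (simp_all add: a_def s_def)
    moreover have "(a + r) / (s + 1) = a / s + (r - a / s) / (s + 1)" for r
    proof -
      have "a / s = (a + a / s) / (s + 1)" using s(1) by (simp add: divide_simps) (simp add: algebra_simps)
      also have "\<dots> + (r - a / s) / (s + 1) = (a + r) / (s + 1)"
        by (simp add: add_divide_distrib[symmetric])
      finally show ?thesis by simp
    qed
    ultimately show ?thesis using s(2) by simp
  qed
  have eps0: "0 \<le> \<epsilon> j" for j using m_nonneg[of j] by (simp add: \<epsilon>_def)
  have eps: "\<epsilon> \<longlonglongrightarrow> 0"
  proof (rule tendsto_sandwich[OF _ _ tendsto_const])
    show "\<forall>\<^sub>F j in sequentially. 0 \<le> \<epsilon> j" using eps0 by simp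
    show "\<forall>\<^sub>F j in sequentially. \<epsilon> j \<le> (sqrt (real j + 2) + 2) / (real j + 2)"
    proof (intro always_eventually allI)
      fix j
      have "m j \<le> sqrt (real j + 2) + 1"
        using slow_grid_bounds(2)[of "Suc j"] by (simp add: m_def add.commute)
      then show "\<epsilon> j \<le> (sqrt (real j + 2) + 2) / (real j + 2)"
        by (simp add: \<epsilon>_def add.commute divide_right_mono)
    qed
    show "(\<lambda>j. (sqrt (real j + 2) + 2) / (real j + 2)) \<longlonglongrightarrow> 0" by real_asymp
  qed
  have T0: "T 0 x y = x * y" if "x \<in> {0..1}" "y \<in> {0..1}" for x y
    using bilinear_interpolant_1[OF assms that] by (simp add: T_avg R_def slow_grid_def)
  have err: "\<bar>T j x y - Q x y\<bar> \<le> 8 / sqrt (real (Suc j))"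
    if "x \<in> {0..1}" "y \<in> {0..1}" for j x y
    unfolding T_def by (rule slow_average_error[OF assms that])
  have err0: "(\<lambda>j. 8 / sqrt (real (Suc j))) \<longlonglongrightarrow> 0" by real_asymp
  obtain C \<gamma> where C: "\<forall>j. copula (C j)"
    and lim: "uniform_limit ({0..1} \<times> {0..1})
      (\<lambda>N (x, y). \<Sum>j=1..N. \<gamma> j * C j x y) (\<lambda>(x, y). Q x y) sequentially"
    and partial: "\<forall>N\<ge>1. \<exists>c>0. \<exists>Q'. quasi_copula Q' \<and>
       (\<forall>x\<in>{0..1}. \<forall>y\<in>{0..1}. (\<Sum>j=1..N. \<gamma> j * C j x y) = c * Q' x y)"
    by atomize_elim
      (rule series_from_small_copula_steps[OF product_copula T0 T P N step eps0 eps err err0])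
  have sums: "(\<lambda>j. \<gamma> (Suc j) * C (Suc j) x y) sums Q x y"
    if "x \<in> {0..1}" "y \<in> {0..1}" for x y
  proof -
    have "(\<lambda>N. \<Sum>j=1..N. \<gamma> j * C j x y) \<longlonglongrightarrow> Q x y"
      using tendsto_uniform_limitI[OF lim, of "(x, y)"] that by simp
    moreover have "(\<Sum>j=1..N. \<gamma> j * C j x y) = (\<Sum>j<N. \<gamma> (Suc j) * C (Suc j) x y)" for N
      by (simp add: sum.atLeast1_atMost_eq)
    ultimately show ?thesis by (simp add: sums_def)
  qed
  \<comment> \<open>At the corner \<open>(1, 1)\<close> the series for \<open>Q\<close> is the series of its coefficients.\<close>
  have "C j 1 1 = 1" for j
    using C by (simp add: copula_def uniform_marginals_def)
  moreover have "Q 1 1 = 1" using quasi_copulaD(3)[OF assms, of 1] by simp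
  ultimately have "(\<lambda>j. \<gamma> (Suc j)) sums 1"
    using sums[of 1 1] by simp
  then show ?thesis
    using C lim partial sums by (intro exI[of _ C] exI[of _ \<gamma>] conjI) simp_all
qed

end
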